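(* Suppose that the standing assumptions (SA1), (SA2), (SA3) of the context hold and that PI is recursively feasible, i.e. $H^i(x)\neq\emptyset$ for every $i\in\mathbb{Z}_{>0}$ and every $x\in\mathbb{R}^{n_x}$. Then the sequence of functions $V^i$ monotonically uniformly converges to $V^\star$ on level sets of $\sigma$, i.e.: (i) for all $i\in\mathbb{Z}_{\ge0}$ and $x\in\mathbb{R}^{n_x}$, $V^{i+1}(x)\le V^i(x)$; (ii) for any $\Delta,\delta>0$ there exists $i^\star\in\mathbb{Z}_{>0}$ such that, for all $x\in\{z\in\mathbb{R}^{n_x}:\sigma(z)\le\Delta\}$ and $i\ge i^\star$, $V^i(x)-V^\star(x)\le\delta$.
   Context: Notation. $\mathbb{R}_{\ge0}=[0,\infty)$, $\mathbb{Z}_{\ge0}=\{0,1,\dots\}$, $\mathbb{Z}_{>0}=\{1,2,\dots\}$. $\mathcal{K}_\infty$: continuous, strictly increasing, unbounded functions $\mathbb{R}_{\ge0}\to\mathbb{R}_{\ge0}$ that are zero at zero. A selection of a set-valued map $S$ is a single-valued $s$ with $s(x)\in S(x)$ for all $x\in\operatorname{dom}S$; one writes $s\in S$. Plant and cost. $x(k+1)=f(x(k),u(k))$ with $x\in\mathbb{R}^{n_x}$, $u\in\mathcal{U}(x)\subseteq\mathbb{R}^{n_u}$, $\mathcal{U}(x)\neq\emptyset$ for every $x$; $\mathcal{W}=\{(x,u):u\in\mathcal{U}(x)\}$. The stage cost is $\ell:\mathbb{R}^{n_x}\times\mathbb{R}^{n_u}\to\mathbb{R}_{\ge0}$. For an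 admissible infinite input sequence $\mathbf{u}$, $J(x,\mathbf{u})=\sum_{k=0}^\infty\ell(x(k),u(k))$ along the resulting solution from $x(0)=x$. For a policy $h\in\mathcal{U}$, $\phi(k,x,h)$ is the closed-loop solution from $x$ and $J(x,h)=\sum_{k=0}^\infty\ell(\phi(k,x,h),h(\phi(k,x,h)))$. $V^\star(x)=\min_{\mathbf{u}}J(x,\mathbf{u})$. Standing assumptions. $\sigma:\mathbb{R}^{n_x}\to\mathbb{R}_{\ge0}$ is continuous, and $h^0\in\mathcal{U}$ is a given initial policy. (SA1) For every $x$ there is an admissible input sequence $\mathbf{u}^\star(x)$ attaining the minimum $V^\star(x)=J(x,\mathbf{u}^\star(x))<+\infty$. (SA2) There exist a continuous $W:\mathbb{R}^{n_x}\to\mathbb{R}_{\ge0}$, $\alpha_W,\chi_W\in\mathcal{K}_\infty$ and $\overline\alpha_W:\mathbb{R}_{\ge0}\to\mathbb{R}_{\ge0}$ continuous, nondecreasing and zero at zero such that for all $(x,u)\in\mathcal{W}$: $W(x)\le\overline\alpha_W(\sigma(x))$ and $W(f(x,u))-W(x)\le-\alpha_W(\sigma(x))+\chi_W(\ell(x,u))$. (SA3) There exists $\overline\alpha_V\in\mathcal{K}_\infty$ with $J(x,h^0)\le\overline\alpha_V(\sigma(x))$ for all $x\in\mathbb{R}^{n_x}$. Policy iteration (PI). $V^0:=J(\cdot,h^0)$. For $i\in\mathbb{Z}_{\ge0}$: $H^{i+1}(x):=\operatorname{argmin}_{u\in\mathcal{U}(x)}\{\ell(x,u)+V^i(f(x,u))\}$;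 an arbitrary selection $h^{i+1}\in H^{i+1}$ is taken; $V^{i+1}:=J(\cdot,h^{i+1})$. *)

theory Defs
  imports "HOL-Analysis.Analysis"
begin

text \<open>
  States live in \<open>real ^ 'n\<close>, inputs in \<open>real ^ 'm\<close>. Comparison functions on \<open>[0, \<infinity>)\<close> are
  represented by functions on \<^typ>\<open>real\<close> of which only the values on \<open>{0..}\<close> matter.
  Costs take values in \<^typ>\<open>ennreal\<close>, since an infinite-horizon cost may be infinite.
  Subtraction on \<^typ>\<open>ennreal\<close> is truncated below at 0, which does not affect a bound
  \<open>V - V' \<le> ennreal \<delta>\<close> with \<open>\<delta> > 0\<close>.
\<close>

definition class_K_inf :: "(real \<Rightarrow> real) \<Rightarrow> bool" where
  "class_K_inf \<alpha> \<longleftrightarrow>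
     continuous_on {0..} \<alpha> \<and> strict_mono_on {0..} \<alpha> \<and> \<not> bdd_above (\<alpha> ` {0..}) \<and> \<alpha> 0 = 0"

definition selection :: "('a \<Rightarrow> 'b) \<Rightarrow> ('a \<Rightarrow> 'b set) \<Rightarrow> bool" where
  "selection s S \<longleftrightarrow> (\<forall>x. S x \<noteq> {} \<longrightarrow> s x \<in> S x)"

primrec traj :: "(real ^ 'n \<Rightarrow> real ^ 'm \<Rightarrow> real ^ 'n) \<Rightarrow> real ^ 'n \<Rightarrow> (nat \<Rightarrow> real ^ 'm)
    \<Rightarrow> nat \<Rightarrow> real ^ 'n" where
  "traj f x u 0 = x"
| "traj f x u (Suc k) = f (traj f x u k) (u k)"

definition admissible :: "(real ^ 'n \<Rightarrow> real ^ 'm \<Rightarrow> real ^ 'n) \<Rightarrow> (real ^ 'n \<Rightarrow> (real ^ 'm) set)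
    \<Rightarrow> real ^ 'n \<Rightarrow> (nat \<Rightarrow> real ^ 'm) \<Rightarrow> bool" where
  "admissible f U x u \<longleftrightarrow> (\<forall>k. u k \<in> U (traj f x u k))"

definition cost_seq :: "(real ^ 'n \<Rightarrow> real ^ 'm \<Rightarrow> real ^ 'n) \<Rightarrow> (real ^ 'n \<Rightarrow> real ^ 'm \<Rightarrow> real)
    \<Rightarrow> real ^ 'n \<Rightarrow> (nat \<Rightarrow> real ^ 'm) \<Rightarrow> ennreal" where
  "cost_seq f l x u = (\<Sum>k. ennreal (l (traj f x u k) (u k)))"

primrec closed_loop :: "(real ^ 'n \<Rightarrow> real ^ 'm \<Rightarrow> real ^ 'n) \<Rightarrow> nat \<Rightarrow> real ^ 'n
    \<Rightarrow> (real ^ 'n \<Rightarrow> real ^ 'm) \<Rightarrow> real ^ 'n" where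
  "closed_loop f 0 x h = x"
| "closed_loop f (Suc k) x h = f (closed_loop f k x h) (h (closed_loop f k x h))"

definition cost_policy :: "(real ^ 'n \<Rightarrow> real ^ 'm \<Rightarrow> real ^ 'n) \<Rightarrow> (real ^ 'n \<Rightarrow> real ^ 'm \<Rightarrow> real)
    \<Rightarrow> real ^ 'n \<Rightarrow> (real ^ 'n \<Rightarrow> real ^ 'm) \<Rightarrow> ennreal" where
  "cost_policy f l x h = (\<Sum>k. ennreal (l (closed_loop f k x h) (h (closed_loop f k x h))))"

text \<open>The optimal value is written as an infimum; that it is attained (hence a minimum) is
  part of the standing assumption \<open>optimum_attained\<close> below.\<close>

definition V_star :: "(real ^ 'n \<Rightarrow> real ^ 'm \<Rightarrow> real ^ 'n) \<Rightarrow> (real ^ 'n \<Rightarrow> (real ^ 'm) set)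
    \<Rightarrow> (real ^ 'n \<Rightarrow> real ^ 'm \<Rightarrow> real) \<Rightarrow> real ^ 'n \<Rightarrow> ennreal" where
  "V_star f U l x = (INF u \<in> {u. admissible f U x u}. cost_seq f l x u)"

definition optimum_attained :: "(real ^ 'n \<Rightarrow> real ^ 'm \<Rightarrow> real ^ 'n) \<Rightarrow> (real ^ 'n \<Rightarrow> (real ^ 'm) set)
    \<Rightarrow> (real ^ 'n \<Rightarrow> real ^ 'm \<Rightarrow> real) \<Rightarrow> bool" where
  "optimum_attained f U l \<longleftrightarrow>
     (\<forall>x. \<exists>u. admissible f U x u \<and> V_star f U l x = cost_seq f l x u \<and> cost_seq f l x u < \<infinity>)"

definition detectable :: "(real ^ 'n \<Rightarrow> real ^ 'm \<Rightarrow> real ^ 'n) \<Rightarrow> (real ^ 'n \<Rightarrow> (real ^ 'm) set)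
    \<Rightarrow> (real ^ 'n \<Rightarrow> real ^ 'm \<Rightarrow> real) \<Rightarrow> (real ^ 'n \<Rightarrow> real) \<Rightarrow> bool" where
  "detectable f U l \<sigma> \<longleftrightarrow>
     (\<exists>W \<alpha> \<gamma> \<beta>.
        continuous_on UNIV W \<and> (\<forall>x. 0 \<le> W x) \<and>
        class_K_inf \<alpha> \<and> class_K_inf \<gamma> \<and>
        continuous_on {0..} \<beta> \<and> mono_on {0..} \<beta> \<and> \<beta> 0 = 0 \<and>
        (\<forall>x. \<forall>u \<in> U x. W x \<le> \<beta> (\<sigma> x) \<and> W (f x u) - W x \<le> - \<alpha> (\<sigma> x) + \<gamma> (l x u)))"

definition initial_cost_bound :: "(real ^ 'n \<Rightarrow> real ^ 'm \<Rightarrow> real ^ 'n)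
    \<Rightarrow> (real ^ 'n \<Rightarrow> real ^ 'm \<Rightarrow> real) \<Rightarrow> (real ^ 'n \<Rightarrow> real) \<Rightarrow> (real ^ 'n \<Rightarrow> real ^ 'm) \<Rightarrow> bool" where
  "initial_cost_bound f l \<sigma> h0 \<longleftrightarrow>
     (\<exists>\<alpha>. class_K_inf \<alpha> \<and> (\<forall>x. cost_policy f l x h0 \<le> ennreal (\<alpha> (\<sigma> x))))"

text \<open>In the following, \<open>h\<close> is the whole sequence of policies; \<open>PI_H f U l h i\<close> depends on
  \<open>h\<close> only through \<open>h (i - 1)\<close> and is meaningful for \<open>i > 0\<close>.\<close>

definition PI_V :: "(real ^ 'n \<Rightarrow> real ^ 'm \<Rightarrow> real ^ 'n) \<Rightarrow> (real ^ 'n \<Rightarrow> real ^ 'm \<Rightarrow> real)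
    \<Rightarrow> (nat \<Rightarrow> real ^ 'n \<Rightarrow> real ^ 'm) \<Rightarrow> nat \<Rightarrow> real ^ 'n \<Rightarrow> ennreal" where
  "PI_V f l h i x = cost_policy f l x (h i)"

definition PI_H :: "(real ^ 'n \<Rightarrow> real ^ 'm \<Rightarrow> real ^ 'n) \<Rightarrow> (real ^ 'n \<Rightarrow> (real ^ 'm) set)
    \<Rightarrow> (real ^ 'n \<Rightarrow> real ^ 'm \<Rightarrow> real) \<Rightarrow> (nat \<Rightarrow> real ^ 'n \<Rightarrow> real ^ 'm) \<Rightarrow> nat
    \<Rightarrow> real ^ 'n \<Rightarrow> (real ^ 'm) set" where
  "PI_H f U l h i x =
     {u. is_arg_min (\<lambda>u. ennreal (l x u) + PI_V f l h (i - 1) (f x u)) (\<lambda>u. u \<in> U x) u}"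

definition policy_iteration :: "(real ^ 'n \<Rightarrow> real ^ 'm \<Rightarrow> real ^ 'n) \<Rightarrow> (real ^ 'n \<Rightarrow> (real ^ 'm) set)
    \<Rightarrow> (real ^ 'n \<Rightarrow> real ^ 'm \<Rightarrow> real) \<Rightarrow> (real ^ 'n \<Rightarrow> real ^ 'm)
    \<Rightarrow> (nat \<Rightarrow> real ^ 'n \<Rightarrow> real ^ 'm) \<Rightarrow> bool" where
  "policy_iteration f U l h0 h \<longleftrightarrow>
     h 0 = h0 \<and> (\<forall>i. selection (h (Suc i)) (PI_H f U l h (Suc i)))"

definition recursively_feasible :: "(real ^ 'n \<Rightarrow> real ^ 'm \<Rightarrow> real ^ 'n)
    \<Rightarrow> (real ^ 'n \<Rightarrow> (real ^ 'm) set) \<Rightarrow> (real ^ 'n \<Rightarrow> real ^ 'm \<Rightarrow> real)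
    \<Rightarrow> (nat \<Rightarrow> real ^ 'n \<Rightarrow> real ^ 'm) \<Rightarrow> bool" where
  "recursively_feasible f U l h \<longleftrightarrow> (\<forall>i>0. \<forall>x. PI_H f U l h i x \<noteq> {})"

end

theory Submission
  imports Defs
begin

text \<open>
  Policy improvement makes each \<open>V\<^sup>i\<close> decrease in \<open>i\<close>, and it also gives
  \<open>V\<^sup>i\<^sup>+\<^sup>1 x \<le> l x u + V\<^sup>i (f x u)\<close> for every admissible \<open>u\<close>. Unrolling the latter along an optimal
  trajectory \<open>x\<^sub>0, x\<^sub>1, \<dots>\<close> yields \<open>V\<^sup>i x \<le> V\<^sup>\<star> x + V\<^sup>0 x\<^sub>i\<close>. By monotonicity it therefore suffices
  that some \<open>x\<^sub>j\<close> with \<open>j \<le> i\<close> has small \<open>\<sigma>\<close>, with a bound on \<open>j\<close> uniform over the level set. Such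
  a \<open>j\<close> exists because the detectability inequality, summed along the trajectory, bounds the sum of
  \<open>\<alpha> (\<sigma> x\<^sub>j)\<close> by a constant plus the sum of \<open>\<gamma> (l x\<^sub>j u\<^sub>j)\<close>, while the total stage cost is
  bounded uniformly.
\<close>

section \<open>Comparison functions and entry times\<close>

lemma class_K_inf_small_value:
  assumes "class_K_inf \<alpha>" and "c > 0"
  obtains e where "e > 0" and "\<alpha> e \<le> c"
proof -
  have "continuous_on {0..} \<alpha>" and "\<alpha> 0 = 0"
    using assms(1) by (auto simp: class_K_inf_def)
  then have "\<exists>d>0. \<forall>t\<in>{0..}. dist t 0 < d \<longrightarrow> dist (\<alpha> t) (\<alpha> 0) < c"
    using assms(2) unfolding continuous_on_iff by (blast intro: order_refl atLeast_iff[THEN iffD2])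
  then obtain d where d: "d > 0" "\<And>t. t \<ge> 0 \<Longrightarrow> dist t 0 < d \<Longrightarrow> dist (\<alpha> t) (\<alpha> 0) < c"
    by auto
  have "dist (\<alpha> (d/2)) (\<alpha> 0) < c"
    using d(1) by (intro d(2)) auto
  then have "\<alpha> (d/2) \<le> c"
    using \<open>\<alpha> 0 = 0\<close> by (simp add: dist_real_def)
  with d(1) show thesis by (intro that[of "d/2"]) auto
qed

lemma class_K_inf_mono:
  assumes "class_K_inf \<alpha>" and "0 \<le> s" and "s \<le> t"
  shows "\<alpha> s \<le> \<alpha> t"
  using assms strict_mono_onD[of "{0..}" \<alpha> s t]
  by (cases "s = t") (auto simp: class_K_inf_def)

lemma class_K_inf_pos:
  assumes "class_K_inf \<alpha>" and "0 < t"
  shows "0 < \<alpha> t"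
  using assms strict_mono_onD[of "{0..}" \<alpha> 0 t] by (auto simp: class_K_inf_def)

lemma class_K_inf_nonneg:
  assumes "class_K_inf \<alpha>" and "0 \<le> t"
  shows "0 \<le> \<alpha> t"
  using class_K_inf_mono[OF assms(1) order_refl assms(2)] assms(1) by (simp add: class_K_inf_def)

text \<open>Up to \<open>e\<close> the constant term suffices; beyond it \<open>t / e\<close>
  exceeds 1, so the linear term dominates \<open>\<gamma> M\<close>. This converts a bound on a sum
  of costs into one on the sum of their \<open>\<gamma>\<close>-values, at the price of
  \<open>\<gamma> e\<close> per step.\<close>

lemma class_K_inf_affine_bound:
  assumes "class_K_inf \<gamma>" and "0 < e" and "0 \<le> t" and "t \<le> M"
  shows "\<gamma> t \<le> \<gamma> e + \<gamma> M / e * t"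
proof (cases "t \<le> e")
  case True
  have "\<gamma> t \<le> \<gamma> e" using assms(1,3) True by (rule class_K_inf_mono)
  moreover have "0 \<le> \<gamma> M / e * t"
    using assms class_K_inf_nonneg[of \<gamma> M] by auto
  ultimately show ?thesis by linarith
next
  case False
  have M: "0 \<le> \<gamma> M" using assms class_K_inf_nonneg[of \<gamma> M] by auto
  have "\<gamma> t \<le> \<gamma> M" using assms(1,3,4) by (rule class_K_inf_mono)
  also have "\<gamma> M * 1 \<le> \<gamma> M * (t / e)"
    using False M assms by (intro mult_left_mono) auto
  finally show ?thesis
    using class_K_inf_nonneg[of \<gamma> e] assms by simp
qed

text \<open>As long as \<open>r\<close> exceeds \<open>s\<close>, \<open>w\<close> loses at least
  \<open>\<alpha> s / 2\<close> per step, up to a total gain limited by the cost budget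
  \<open>M\<close>; this cannot last, since \<open>w\<close> stays nonnegative. \<open>N\<close> is
  fixed before \<open>w\<close>, \<open>r\<close>, \<open>c\<close>, which gives the uniformity over
  a level set.\<close>

lemma uniformly_small_entry:
  fixes \<alpha> \<gamma> :: "real \<Rightarrow> real"
  assumes \<alpha>: "class_K_inf \<alpha>" and \<gamma>: "class_K_inf \<gamma>" and s: "0 < s"
  obtains N :: nat where "0 < N"
    and "\<And>w r c. \<lbrakk>\<And>j. 0 \<le> w j; w 0 \<le> (B::real); \<And>j. 0 \<le> c j;
           sum c {..<N} \<le> M; \<And>j. w (Suc j) - w j \<le> - \<alpha> (r j) + \<gamma> (c j)\<rbrakk>
         \<Longrightarrow> \<exists>j<N. r j \<le> s"
proof -
  have as: "0 < \<alpha> s" using \<alpha> s by (rule class_K_inf_pos)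
  \<comment> \<open>With this \<open>e\<close>, the constant term of the affine bound uses up at
    most half of the decrease \<open>\<alpha> s\<close>.\<close>
  obtain e where e: "e > 0" "\<gamma> e \<le> \<alpha> s / 2"
    using class_K_inf_small_value[OF \<gamma>, of "\<alpha> s / 2"] as by auto
  define C where "C = B + \<gamma> M / e * M"
  \<comment> \<open>The \<open>max 0\<close> secures \<open>0 < N\<close>, as the signs of
    \<open>B\<close> and \<open>M\<close> are not prescribed.\<close>
  obtain N :: nat where N: "real N > max 0 (2 * C / \<alpha> s)"
    using reals_Archimedean2 by blast
  show thesis
  proof (rule that[of N])
    show "0 < N" using N by simp
    fix w r c :: "nat \<Rightarrow> real"
    assume w: "\<And>j. 0 \<le> w j" and w0: "w 0 \<le> B" and c: "\<And>j. 0 \<le> c j"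
      and cM: "sum c {..<N} \<le> M" and step: "\<And>j. w (Suc j) - w j \<le> - \<alpha> (r j) + \<gamma> (c j)"
    show "\<exists>j<N. r j \<le> s"
    proof (rule ccontr)
      assume "\<not> (\<exists>j<N. r j \<le> s)"
      then have r_large: "\<alpha> s \<le> \<alpha> (r j)" if "j < N" for j
        using that s by (auto simp: not_le less_imp_le intro: class_K_inf_mono[OF \<alpha>])
      have M: "0 \<le> M" using cM sum_nonneg[of "{..<N}" c] c by auto
      have c_le: "c j \<le> M" if "j < N" for j
        using member_le_sum[of j "{..<N}" c] that c cM by auto
      have "w N - w 0 = (\<Sum>j<N. w (Suc j) - w j)"
        by (rule sum_lessThan_telescope[symmetric])
      also have "\<dots> \<le> (\<Sum>j<N. - \<alpha> s + (\<gamma> e + \<gamma> M / e * c j))"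
      proof (rule sum_mono)
        fix j assume "j \<in> {..<N}"
        then have "\<gamma> (c j) \<le> \<gamma> e + \<gamma> M / e * c j" "\<alpha> s \<le> \<alpha> (r j)"
          using class_K_inf_affine_bound[OF \<gamma> e(1) c c_le] r_large by auto
        then show "w (Suc j) - w j \<le> - \<alpha> s + (\<gamma> e + \<gamma> M / e * c j)"
          using step[of j] by linarith
      qed
      also have "\<dots> = real N * (\<gamma> e - \<alpha> s) + \<gamma> M / e * sum c {..<N}"
        by (simp add: sum.distrib sum_subtractf sum_distrib_left sum_divide_distrib algebra_simps)
      also have "\<dots> \<le> real N * (- \<alpha> s / 2) + \<gamma> M / e * M"
        using e cM class_K_inf_nonneg[OF \<gamma> M] by (intro add_mono mult_left_mono) auto
      finally have "real N * \<alpha> s \<le> 2 * C"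
        using w[of N] w0 by (simp add: C_def field_simps)
      then show False using N as by (simp add: field_simps)
    qed
  qed
qed

section \<open>Cost of a fixed policy\<close>

lemma closed_loop_Suc_shift:
  "closed_loop f (Suc k) x h = closed_loop f k (f x (h x)) h"
  by (induction k) simp_all

lemma cost_policy_unfold:
  "cost_policy f l x h = ennreal (l x (h x)) + cost_policy f l (f x (h x)) h"
proof -
  define g where "g k = ennreal (l (closed_loop f k x h) (h (closed_loop f k x h)))" for k
  have "suminf g = g 0 + (\<Sum>k. g (Suc k))"
    using suminf_offset[of g 1] by simp
  then show ?thesis
    unfolding g_def cost_policy_def closed_loop_Suc_shift by simp
qed

text \<open>Iterating the hypothesis along the closed loop bounds each partial cost plus a remainder
  by \<open>V x\<close>. No subtraction occurs, so \<open>V\<close> may take the value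
  infinity.\<close>

lemma cost_policy_le_of_decrease:
  fixes V :: "real ^ 'n \<Rightarrow> ennreal"
  assumes "\<And>x. ennreal (l x (h x)) + V (f x (h x)) \<le> V x"
  shows "cost_policy f l x h \<le> V x"
proof -
  have "(\<Sum>k<N. ennreal (l (closed_loop f k x h) (h (closed_loop f k x h))))
      + V (closed_loop f N x h) \<le> V x" for N
  proof (induction N)
    case (Suc N)
    let ?y = "closed_loop f N x h"
    have "(\<Sum>k<Suc N. ennreal (l (closed_loop f k x h) (h (closed_loop f k x h))))
        + V (closed_loop f (Suc N) x h)
      = (\<Sum>k<N. ennreal (l (closed_loop f k x h) (h (closed_loop f k x h))))
        + (ennreal (l ?y (h ?y)) + V (f ?y (h ?y)))"
      by (simp add: add.assoc)
    also have "\<dots> \<le> (\<Sum>k<N. ennreal (l (closed_loop f k x h) (h (closed_loop f k x h)))) + V ?y"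
      by (intro add_left_mono assms)
    finally show ?case using Suc by (rule order_trans)
  qed simp
  then have "(\<Sum>k<N. ennreal (l (closed_loop f k x h) (h (closed_loop f k x h)))) \<le> V x" for N
    by (meson le_iff_add order_trans)
  then show ?thesis
    unfolding cost_policy_def suminf_eq_SUP by (intro SUP_least)
qed

lemma V_star_le_cost_policy:
  assumes "\<And>x. h x \<in> U x"
  shows "V_star f U l x \<le> cost_policy f l x h"
proof -
  define u where "u k = h (closed_loop f k x h)" for k
  have traj: "traj f x u k = closed_loop f k x h" for k
    by (induction k) (simp_all add: u_def)
  have "admissible f U x u"
    using assms by (simp add: admissible_def traj) (simp add: u_def)
  then have "V_star f U l x \<le> cost_seq f l x u"
    unfolding V_star_def by (intro INF_lower) simp
  also have "\<dots> = cost_policy f l x h"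
    by (simp add: cost_seq_def cost_policy_def traj) (simp add: u_def)
  finally show ?thesis .
qed

section \<open>Policy improvement and comparison with arbitrary inputs\<close>

lemma PI_policy_mem:
  assumes "\<And>x. U x \<noteq> {}" and "selection h0 U"
    and "policy_iteration f U l h0 h" and "recursively_feasible f U l h"
  shows "h i x \<in> U x"
proof (cases i)
  case 0
  then show ?thesis using assms by (auto simp: selection_def policy_iteration_def)
next
  case (Suc j)
  have "h (Suc j) x \<in> PI_H f U l h (Suc j) x"
    using assms(3,4) by (auto simp: selection_def policy_iteration_def recursively_feasible_def)
  then show ?thesis using Suc by (simp add: PI_H_def is_arg_min_def)
qed

lemma PI_improvement:
  assumes "policy_iteration f U l h0 h" and "recursively_feasible f U l h" and "u \<in> U x"
  shows "ennreal (l x (h (Suc i) x)) + PI_V f l h i (f x (h (Suc i) x))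
    \<le> ennreal (l x u) + PI_V f l h i (f x u)"
proof -
  have "h (Suc i) x \<in> PI_H f U l h (Suc i) x"
    using assms(1,2) by (auto simp: selection_def policy_iteration_def recursively_feasible_def)
  then show ?thesis using assms(3) by (auto simp: PI_H_def is_arg_min_def not_less)
qed

text \<open>Comparing the minimizer with the old input \<open>h i y\<close> and unfolding the old
  cost once shows that \<open>PI_V f l h i\<close> satisfies the decrease condition for the new
  policy.\<close>

lemma PI_V_Suc_le:
  assumes "policy_iteration f U l h0 h" and "recursively_feasible f U l h"
    and "\<And>x. h i x \<in> U x"
  shows "PI_V f l h (Suc i) x \<le> PI_V f l h i x"
proof -
  have "ennreal (l y (h (Suc i) y)) + PI_V f l h i (f y (h (Suc i) y)) \<le> PI_V f l h i y" for y
    using PI_improvement[OF assms(1,2) assms(3)[of y], of i]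
    by (simp add: PI_V_def cost_policy_unfold[of f l y "h i"])
  then have "cost_policy f l x (h (Suc i)) \<le> PI_V f l h i x"
    by (rule cost_policy_le_of_decrease)
  then show ?thesis by (simp add: PI_V_def)
qed

lemma PI_V_Suc_le_Bellman:
  assumes "policy_iteration f U l h0 h" and "recursively_feasible f U l h"
    and "\<And>x. h i x \<in> U x" and "u \<in> U x"
  shows "PI_V f l h (Suc i) x \<le> ennreal (l x u) + PI_V f l h i (f x u)"
proof -
  let ?y = "f x (h (Suc i) x)"
  have "PI_V f l h (Suc i) x = ennreal (l x (h (Suc i) x)) + PI_V f l h (Suc i) ?y"
    unfolding PI_V_def by (rule cost_policy_unfold)
  also have "\<dots> \<le> ennreal (l x (h (Suc i) x)) + PI_V f l h i ?y"
    by (intro add_left_mono PI_V_Suc_le[OF assms(1-3)])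
  also have "\<dots> \<le> ennreal (l x u) + PI_V f l h i (f x u)"
    using assms by (intro PI_improvement)
  finally show ?thesis .
qed

text \<open>Each use of the Bellman inequality lowers the iteration index by one and advances time
  by one, hence the induction over \<open>i\<close> with \<open>k\<close> arbitrary.\<close>

lemma PI_V_le_traj:
  assumes "policy_iteration f U l h0 h" and "recursively_feasible f U l h"
    and "\<And>i x. h i x \<in> U x" and "admissible f U x u"
  shows "PI_V f l h i (traj f x u k)
    \<le> (\<Sum>j<i. ennreal (l (traj f x u (k + j)) (u (k + j)))) + PI_V f l h 0 (traj f x u (k + i))"
proof (induction i arbitrary: k)
  case (Suc i)
  have "PI_V f l h (Suc i) (traj f x u k)
      \<le> ennreal (l (traj f x u k) (u k)) + PI_V f l h i (traj f x u (Suc k))"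
    using PI_V_Suc_le_Bellman[OF assms(1-3), of "u k" "traj f x u k" i] assms(4)
    by (simp add: admissible_def)
  also have "\<dots> \<le> ennreal (l (traj f x u k) (u k))
      + ((\<Sum>j<i. ennreal (l (traj f x u (Suc k + j)) (u (Suc k + j))))
         + PI_V f l h 0 (traj f x u (Suc k + i)))"
    by (intro add_left_mono Suc.IH)
  finally show ?case
    by (simp add: sum.lessThan_Suc_shift add.assoc del: sum.lessThan_Suc)
qed simp

theorem proposition1:
  fixes f :: "real ^ 'n \<Rightarrow> real ^ 'm \<Rightarrow> real ^ 'n"
    and U :: "real ^ 'n \<Rightarrow> (real ^ 'm) set"
    and l :: "real ^ 'n \<Rightarrow> real ^ 'm \<Rightarrow> real"
    and \<sigma> :: "real ^ 'n \<Rightarrow> real"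
    and h0 :: "real ^ 'n \<Rightarrow> real ^ 'm"
    and h :: "nat \<Rightarrow> real ^ 'n \<Rightarrow> real ^ 'm"
  assumes U_nonempty: "\<And>x. U x \<noteq> {}"
    and l_nonneg: "\<And>x u. 0 \<le> l x u"
    and \<sigma>_cont: "continuous_on UNIV \<sigma>"
    and \<sigma>_nonneg: "\<And>x. 0 \<le> \<sigma> x"
    and h0: "selection h0 U"
    and SA1: "optimum_attained f U l"
    and SA2: "detectable f U l \<sigma>"
    and SA3: "initial_cost_bound f l \<sigma> h0"
    and PI: "policy_iteration f U l h0 h"
    and feasible: "recursively_feasible f U l h"
  shows "(\<forall>i x. PI_V f l h (i + 1) x \<le> PI_V f l h i x) \<and>
         (\<forall>\<Delta>>0. \<forall>\<delta>>0. \<exists>i\<^sub>0>0. \<forall>x \<in> {z. \<sigma> z \<le> \<Delta>}. \<forall>i\<ge>i\<^sub>0.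
            PI_V f l h i x - V_star f U l x \<le> ennreal \<delta>)"
proof (intro conjI allI impI)
  have mem: "h i x \<in> U x" for i x
    using U_nonempty h0 PI feasible by (rule PI_policy_mem)
  have dec: "PI_V f l h (Suc i) x \<le> PI_V f l h i x" for i x
    using PI feasible mem by (rule PI_V_Suc_le)
  then show "PI_V f l h (i + 1) x \<le> PI_V f l h i x" for i x
    by simp
  have antimono: "PI_V f l h i x \<le> PI_V f l h j x" if "j \<le> i" for i j x
    using that dec by (rule lift_Suc_antimono_le[rotated])
  obtain W \<alpha> \<gamma> \<beta> where W: "\<And>x. 0 \<le> W x" and \<alpha>: "class_K_inf \<alpha>" and \<gamma>: "class_K_inf \<gamma>"
    and \<beta>: "mono_on {0..} \<beta>"
    and W_le: "\<And>x u. u \<in> U x \<Longrightarrow> W x \<le> \<beta> (\<sigma> x)"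
    and W_step: "\<And>x u. u \<in> U x \<Longrightarrow> W (f x u) - W x \<le> - \<alpha> (\<sigma> x) + \<gamma> (l x u)"
    using SA2 unfolding detectable_def by blast
  obtain a where a: "class_K_inf a" and V0_h0: "\<And>x. cost_policy f l x h0 \<le> ennreal (a (\<sigma> x))"
    using SA3 unfolding initial_cost_bound_def by blast
  have V0: "PI_V f l h 0 x \<le> ennreal (a (\<sigma> x))" for x
    using V0_h0 PI by (simp add: PI_V_def policy_iteration_def)

  fix \<Delta> \<delta> :: real
  assume \<Delta>: "\<Delta> > 0" and \<delta>: "\<delta> > 0"
  \<comment> \<open>Where \<open>\<sigma>\<close> is at most \<open>s\<close>, the initial policy
    costs at most \<open>\<delta>\<close>.\<close>
  obtain s where s: "s > 0" "a s \<le> \<delta>"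
    using class_K_inf_small_value[OF a \<delta>] .
  \<comment> \<open>\<open>\<beta> \<Delta>\<close> will bound the initial value of \<open>W\<close>
    and \<open>a \<Delta>\<close> the optimal cost, both for every \<open>x\<close> in the level
    set.\<close>
  obtain N where N: "0 < N" and
    N_small: "\<And>w r c. \<lbrakk>\<And>j. 0 \<le> w j; w 0 \<le> \<beta> \<Delta>; \<And>j. 0 \<le> c j;
           sum c {..<N} \<le> a \<Delta>; \<And>j. w (Suc j) - w j \<le> - \<alpha> (r j) + \<gamma> (c j)\<rbrakk>
         \<Longrightarrow> \<exists>j<N. r j \<le> s"
    using uniformly_small_entry[OF \<alpha> \<gamma> s(1), of "\<beta> \<Delta>" "a \<Delta>"] by blast
  have "PI_V f l h i x - V_star f U l x \<le> ennreal \<delta>" if x: "\<sigma> x \<le> \<Delta>" and i: "N \<le> i" for x i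
  proof -
    obtain u where u: "admissible f U x u" and opt: "V_star f U l x = cost_seq f l x u"
      and fin: "cost_seq f l x u < \<infinity>"
      using SA1 unfolding optimum_attained_def by blast
    define c where "c j = l (traj f x u j) (u j)" for j
    have u_mem: "u j \<in> U (traj f x u j)" for j
      using u by (simp add: admissible_def)
    have partial: "ennreal (sum c {..<n}) \<le> V_star f U l x" for n
    proof -
      have "ennreal (sum c {..<n}) = (\<Sum>j<n. ennreal (c j))"
        by (simp add: c_def l_nonneg)
      also have "\<dots> \<le> (\<Sum>j. ennreal (c j))"
        by (intro sum_le_suminf) auto
      finally show ?thesis by (simp add: opt cost_seq_def c_def)
    qed
    \<comment> \<open>The optimal cost is at most that of \<open>h 0\<close>, which SA3 bounds on
      the level set.\<close>
    have "ennreal (sum c {..<N}) \<le> PI_V f l h 0 x"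
      using partial V_star_le_cost_policy[of "h 0" U f l x] mem
      unfolding PI_V_def by (meson order_trans)
    also have "\<dots> \<le> ennreal (a (\<sigma> x))" by (rule V0)
    also have "\<dots> \<le> ennreal (a \<Delta>)"
      by (rule ennreal_leI[OF class_K_inf_mono[OF a \<sigma>_nonneg x]])
    finally have cN: "sum c {..<N} \<le> a \<Delta>"
      using class_K_inf_nonneg[OF a, of \<Delta>] \<Delta> by (simp add: ennreal_le_iff)
    have "\<exists>j<N. \<sigma> (traj f x u j) \<le> s"
    proof (rule N_small[where w = "\<lambda>j. W (traj f x u j)" and c = c])
      have "W x \<le> \<beta> (\<sigma> x)" using W_le u_mem[of 0] by simp
      also have "\<dots> \<le> \<beta> \<Delta>"
        using \<beta> \<sigma>_nonneg x \<Delta> by (intro mono_onD[of "{0..}" \<beta>]) auto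
      finally show "W (traj f x u 0) \<le> \<beta> \<Delta>" by simp
      show "W (traj f x u (Suc j)) - W (traj f x u j) \<le> - \<alpha> (\<sigma> (traj f x u j)) + \<gamma> (c j)" for j
        using W_step[OF u_mem] by (simp add: c_def)
    qed (use W l_nonneg cN in \<open>auto simp: c_def\<close>)
    then obtain j where j: "j < N" "\<sigma> (traj f x u j) \<le> s" by blast
    \<comment> \<open>The entry time \<open>j\<close> varies with \<open>x\<close>, but
      \<open>j < N \<le> i\<close> always holds, so monotonicity in the iteration index absorbs this
      dependence.\<close>
    have "PI_V f l h i x \<le> PI_V f l h j x"
      using j i by (intro antimono) auto
    also have "\<dots> \<le> ennreal (sum c {..<j}) + PI_V f l h 0 (traj f x u j)"
      using PI_V_le_traj[OF PI feasible mem u, of j 0] by (simp add: c_def l_nonneg)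
    also have "\<dots> \<le> V_star f U l x + ennreal (a (\<sigma> (traj f x u j)))"
      by (intro add_mono partial V0)
    also have "\<dots> \<le> V_star f U l x + ennreal \<delta>"
      using class_K_inf_mono[OF a \<sigma>_nonneg j(2)] s(2)
      by (intro add_left_mono ennreal_leI) linarith
    \<comment> \<open>Finiteness of the optimal cost rules out \<open>top - top\<close>, which
      equals \<open>top\<close> in \<open>ennreal\<close>.\<close>
    finally show ?thesis
      using fin opt by (subst ennreal_minus_le_iff) (auto simp: add.commute)
  qed
  then show "\<exists>i\<^sub>0>0. \<forall>x \<in> {z. \<sigma> z \<le> \<Delta>}. \<forall>i\<ge>i\<^sub>0.
      PI_V f l h i x - V_star f U l x \<le> ennreal \<delta>"
    using N by (intro exI[of _ N]) auto
qed

end
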